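(* Let $q=p^e$ with $p$ prime, and let $m\ge4$ be an integer with $(m,q)\neq(4,2)$ and $2\mid em$. Let $\epsilon\in\{1,-1\}$ and $r$ a positive integer, and suppose $D\subsetneq\mathbb{F}_{q^m}^*$ is an $\mathbb{F}_q^*$-invariant partial difference set with parameters $$\big(q^m,\ r(\sqrt{q^m}-\epsilon),\ \epsilon\sqrt{q^m}+r^2-3\epsilon r,\ r^2-\epsilon r\big)$$ (of Latin square type if $\epsilon=1$, negative Latin square type if $\epsilon=-1$). Then the code $\mathcal C(M_D)$ is minimal if one of the following holds: (1) $\epsilon=1$, $r\neq\sqrt{q^m}$ and $r>1$; (2) $\epsilon=-1$, $r\neq\sqrt{q^m}-1$ and $r>\dfrac{(q-1)\sqrt{q^m}}{\sqrt{q^m}+q}$.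
   Context: $\mathrm{Tr}=\mathrm{Tr}_{\mathbb{F}_{q^m}/\mathbb{F}_q}$. $D$ is $\mathbb{F}_q^*$-invariant if $\lambda D=D$ for all $\lambda\in\mathbb{F}_q^*$. A strongly regular graph $(v,k,\lambda,\mu)$ is a simple undirected graph, neither complete nor edgeless, that is $k$-regular on $v$ vertices, where adjacent vertices have exactly $\lambda$ and nonadjacent vertices exactly $\mu$ common neighbours. For $D\subseteq\mathbb{F}_{q^m}^*$ with $-D=D$, $\mathrm{Cay}(\mathbb{F}_{q^m},D)$ has vertex set $\mathbb{F}_{q^m}$ with $x\sim y$ iff $x-y\in D$; $D$ is a partial difference set with parameters $(v,k,\lambda,\mu)$ if this graph is strongly regular with these parameters. Code: fix an ordering $x_1,\dots,x_{q^m-1}$ of $\mathbb{F}_{q^m}^*$, let $f_D$ be the characteristic function of $D$ ($1$ on $D$, $0$ elsewhere, in $\mathbb{F}_q$), and for $(u,v)\in\mathbb{F}_q\times\mathbb{F}_{q^m}$ let $c(u,v)=(uf_D(x_i)+\mathrm{Tr}(vx_i))_{1\le i\le q^m-1}$; $\mathcal C(M_D)=\{c(u,v)\}$. A linear code is minimal if whenever codewords $c,c'$ satisfy $\mathrm{supp}(c')\subseteq\mathrm{supp}(c)$ (supports = sets of nonzero coordinates), $c'=\lambda c$ for some $\lambda\in\mathbb{F}_q$. *)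

theory Defs
  imports
    Complex_Main
    "HOL-Computational_Algebra.Primes"
    "Graph_Theory.Pair_Digraph"
begin

text \<open>
  Throughout, the extension field is a finite field type \<open>'a\<close>; the base field is a
  subfield \<open>K\<close> given as a subset of \<open>'a\<close>.
\<close>

definition is_subfield :: "'a::field set \<Rightarrow> bool" where
  "is_subfield K \<longleftrightarrow> 0 \<in> K \<and> 1 \<in> K \<and>
     (\<forall>x\<in>K. \<forall>y\<in>K. x + y \<in> K \<and> x * y \<in> K) \<and>
     (\<forall>x\<in>K. - x \<in> K \<and> inverse x \<in> K)"

text \<open>
  The trace of an extension of degree \<open>m\<close> of a field with \<open>q\<close> elements, as the sum of the
  conjugates under the Frobenius automorphism \<open>x \<mapsto> x ^ q\<close>, which generates the Galois group.
\<close>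

definition field_Tr :: "nat \<Rightarrow> nat \<Rightarrow> 'a::field \<Rightarrow> 'a" where
  "field_Tr q m x = (\<Sum>i<m. x ^ (q ^ i))"

definition scalar_invariant :: "'a::field set \<Rightarrow> 'a set \<Rightarrow> bool" where
  "scalar_invariant K D \<longleftrightarrow> (\<forall>a \<in> K - {0}. (\<lambda>x. a * x) ` D = D)"


text \<open>
  \<open>pair_graph\<close> is the locale of finite loop-free symmetric digraphs without parallel arcs, that is,
  of finite simple undirected graphs with each edge represented by its two orientations.
\<close>

definition neighbours :: "'v pair_pre_digraph \<Rightarrow> 'v \<Rightarrow> 'v set" where
  "neighbours G x = {y. (x, y) \<in> parcs G}"

definition strongly_regular ::
    "'v pair_pre_digraph \<Rightarrow> nat \<Rightarrow> nat \<Rightarrow> nat \<Rightarrow> nat \<Rightarrow> bool" where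
  "strongly_regular G v k l mu \<longleftrightarrow>
     pair_graph G \<and>
     parcs G \<noteq> {} \<and>
     parcs G \<noteq> {(x, y). x \<in> pverts G \<and> y \<in> pverts G \<and> x \<noteq> y} \<and>
     card (pverts G) = v \<and>
     (\<forall>x \<in> pverts G. card (neighbours G x) = k) \<and>
     (\<forall>x \<in> pverts G. \<forall>y \<in> pverts G. (x, y) \<in> parcs G \<longrightarrow>
        card (neighbours G x \<inter> neighbours G y) = l) \<and>
     (\<forall>x \<in> pverts G. \<forall>y \<in> pverts G. x \<noteq> y \<and> (x, y) \<notin> parcs G \<longrightarrow>
        card (neighbours G x \<inter> neighbours G y) = mu)"

definition cayley_graph :: "'a::ab_group_add set \<Rightarrow> 'a pair_pre_digraph" where
  "cayley_graph D = \<lparr> pverts = UNIV, parcs = {(x, y). x - y \<in> D} \<rparr>"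

definition partial_difference_set ::
    "'a::ab_group_add set \<Rightarrow> nat \<Rightarrow> nat \<Rightarrow> nat \<Rightarrow> nat \<Rightarrow> bool" where
  "partial_difference_set D v k l mu \<longleftrightarrow>
     0 \<notin> D \<and> uminus ` D = D \<and> strongly_regular (cayley_graph D) v k l mu"


text \<open>Words of length \<open>n\<close> over \<open>K\<close> are lists of length \<open>n\<close> with entries in \<open>K\<close>.\<close>

definition linear_code :: "'a::field set \<Rightarrow> nat \<Rightarrow> 'a list set \<Rightarrow> bool" where
  "linear_code K n C \<longleftrightarrow>
     C \<subseteq> {c. length c = n \<and> set c \<subseteq> K} \<and>
     replicate n 0 \<in> C \<and>
     (\<forall>c\<in>C. \<forall>c'\<in>C. map2 (+) c c' \<in> C) \<and>
     (\<forall>a\<in>K. \<forall>c\<in>C. map (\<lambda>x. a * x) c \<in> C)"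

definition word_supp :: "'a::zero list \<Rightarrow> nat set" where
  "word_supp c = {i. i < length c \<and> c ! i \<noteq> 0}"

definition minimal_linear_code :: "'a::field set \<Rightarrow> nat \<Rightarrow> 'a list set \<Rightarrow> bool" where
  "minimal_linear_code K n C \<longleftrightarrow>
     linear_code K n C \<and>
     (\<forall>c\<in>C. \<forall>c'\<in>C. word_supp c' \<subseteq> word_supp c \<longrightarrow> (\<exists>a\<in>K. c' = map (\<lambda>x. a * x) c))"

definition char_fun :: "'a set \<Rightarrow> 'a \<Rightarrow> 'a::field" where
  "char_fun D x = (if x \<in> D then 1 else 0)"

text \<open>
  The list \<open>xs\<close> is the chosen ordering of the nonzero field elements.
\<close>

definition codeword ::
    "nat \<Rightarrow> nat \<Rightarrow> 'a list \<Rightarrow> 'a set \<Rightarrow> 'a \<Rightarrow> 'a \<Rightarrow> 'a::field list" where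
  "codeword q m xs D u v = map (\<lambda>x. u * char_fun D x + field_Tr q m (v * x)) xs"

definition code_of ::
    "'a set \<Rightarrow> nat \<Rightarrow> nat \<Rightarrow> 'a list \<Rightarrow> 'a set \<Rightarrow> 'a::field list set" where
  "code_of K q m xs D = {codeword q m xs D u v | u v. u \<in> K}"

end

theory Submission
  imports Defs "HOL-Computational_Algebra.Polynomial"
begin

text \<open>
  Write \<open>s\<close> for the square root of the order of the field. Counting the pairs in \<open>D \<times> D\<close> whose sum
  lies on the hyperplane \<open>Tr (v * x) = 0\<close> shows that the size of the section of \<open>D\<close> by it takes only
  two values, corresponding to the eigenvalues \<open>\<epsilon> * (s - r)\<close> and \<open>- \<epsilon> * r\<close> of the Cayley graph; no
  characters are needed. If the support of the codeword of \<open>(u', v')\<close> lies in that of \<open>(u, v)\<close> and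
  \<open>u \<noteq> 0\<close>, then \<open>D\<close> agrees with the hyperplane of \<open>v\<close> outside the hyperplane of
  \<open>w = v' - (u' / u) * v\<close>. For \<open>w \<noteq> 0\<close> the sections by the hyperplanes of \<open>v\<close> and \<open>v + w\<close> would
  differ by more than two eigenvalues allow, so \<open>w = 0\<close> and the codewords are proportional. If
  \<open>u = 0\<close>, then \<open>D\<close> meets the hyperplane of \<open>v\<close>, and homogeneity of \<open>D\<close> forces \<open>u' = 0\<close> unless
  \<open>q = 2\<close>, where the section sizes again give a contradiction.
\<close>

section \<open>Subfields of a finite field and the trace\<close>

lemma is_subfield_UNIV: "is_subfield UNIV"
  by (simp add: is_subfield_def)

lemma is_subfieldD:
  assumes "is_subfield K"
  shows "0 \<in> K" "1 \<in> K" "x \<in> K \<Longrightarrow> y \<in> K \<Longrightarrow> x + y \<in> K" "x \<in> K \<Longrightarrow> y \<in> K \<Longrightarrow> x * y \<in> K"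
    "x \<in> K \<Longrightarrow> - x \<in> K" "x \<in> K \<Longrightarrow> inverse x \<in> K" "x \<in> K \<Longrightarrow> y \<in> K \<Longrightarrow> x / y \<in> K"
  using assms by (auto simp: is_subfield_def divide_inverse)

text \<open>Multiplication by a nonzero \<open>x\<close> permutes \<open>K - {0}\<close>; comparing
  the products over this set gives \<open>x ^ (card K - 1) = 1\<close>.\<close>

lemma subfield_power_card:
  fixes K :: "'a::{field, finite} set"
  assumes K: "is_subfield K" and x: "x \<in> K"
  shows "x ^ card K = x"
proof (cases "x = 0")
  case True
  have "card K > 0"
    using x by (auto simp: card_gt_0_iff)
  then show ?thesis
    using True by simp
next
  case False
  have "(\<Prod>y\<in>K - {0}. x * y) = (\<Prod>y\<in>K - {0}. y)"
    using False x is_subfieldD[OF K]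
    by (intro prod.reindex_bij_witness[of _ "\<lambda>y. y / x" "\<lambda>y. x * y"]) auto
  moreover have "(\<Prod>y\<in>K - {0}. x * y) = x ^ card (K - {0}) * (\<Prod>y\<in>K - {0}. y)"
    by (simp add: prod.distrib)
  ultimately have "x ^ card (K - {0}) = 1"
    by simp
  moreover have "card K = Suc (card (K - {0}))"
    using is_subfieldD(1)[OF K] card_Suc_Diff1[of K 0] by simp
  ultimately show ?thesis
    by simp
qed

lemma subfield_card_gt_1:
  fixes K :: "'a::{field, finite} set"
  assumes K: "is_subfield K"
  shows "card K > 1"
proof -
  have "card {0, 1 :: 'a} \<le> card K"
    using is_subfieldD[OF K] by (intro card_mono) auto
  then show ?thesis
    by simp
qed

text \<open>The elements of \<open>K\<close> are already as many roots of
  \<open>X ^ card K - X\<close> as its degree allows.\<close>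

lemma power_card_eq_self_iff:
  fixes K :: "'a::{field, finite} set"
  assumes K: "is_subfield K"
  shows "x ^ card K = x \<longleftrightarrow> x \<in> K"
proof
  let ?P = "monom 1 (card K) - monom 1 1 :: 'a poly"
  have gt: "card K > 1"
    by (rule subfield_card_gt_1[OF K])
  have deg: "degree ?P \<le> card K"
    using gt by (intro degree_diff_le) (auto simp: degree_monom_eq)
  have "coeff ?P (card K) = 1"
    using gt by simp
  then have "?P \<noteq> 0"
    by (metis coeff_0 zero_neq_one)
  then have "card {y. poly ?P y = 0} \<le> card K"
    using card_poly_roots_bound deg order.trans by blast
  moreover have "K \<subseteq> {y. poly ?P y = 0}"
    using subfield_power_card[OF K] by (auto simp: poly_monom)
  ultimately have "K = {y. poly ?P y = 0}"
    by (intro card_seteq) auto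
  then show "x \<in> K" if "x ^ card K = x"
    using that by (auto simp: poly_monom)
qed (rule subfield_power_card[OF K])

text \<open>The translation by 1 permutes the field, so summing over all elements shows that the
  field order vanishes in the field.\<close>

lemma CHAR_eq_if_card_prime_power:
  assumes "prime p" and "card (UNIV :: 'a::{field, finite} set) = p ^ n"
  shows "CHAR('a) = p"
proof -
  have "(\<Sum>x\<in>UNIV. x + 1) = (\<Sum>x\<in>UNIV. x :: 'a)"
    by (rule sum.reindex_bij_witness[of _ "\<lambda>y. y - 1" "\<lambda>y. y + 1"]) auto
  then have "of_nat (p ^ n) = (0 :: 'a)"
    by (simp add: sum.distrib assms(2))
  then have "of_nat p = (0 :: 'a)"
    by simp
  then have "CHAR('a) dvd p"
    by (simp add: of_nat_eq_0_iff_char_dvd)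
  then show ?thesis
    using assms(1) by (metis CHAR_not_1' prime_nat_iff One_nat_def)
qed

lemma field_Tr_eq_poly: "field_Tr q m x = poly (\<Sum>i<m. monom 1 (q ^ i)) x"
  by (simp add: field_Tr_def poly_sum poly_monom)

text \<open>The trace is a nonzero polynomial of degree at most \<open>q ^ (m - 1)\<close>, too
  small to vanish at all \<open>q ^ m\<close> elements.\<close>

lemma field_Tr_nonzero:
  assumes "q > 1" and "m > 0" and card: "card (UNIV :: 'a::{field, finite} set) = q ^ m"
  shows "\<exists>x :: 'a. field_Tr q m x \<noteq> 0"
proof (rule ccontr)
  let ?P = "\<Sum>i<m. monom 1 (q ^ i) :: 'a poly"
  assume "\<not> ?thesis"
  then have roots: "{x. poly ?P x = 0} = UNIV"
    by (auto simp: field_Tr_eq_poly)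
  have "coeff ?P (q ^ (m - 1)) = (\<Sum>i<m. if i = m - 1 then 1 else 0)"
    unfolding coeff_sum coeff_monom using assms(1) by (intro sum.cong refl) auto
  then have "coeff ?P (q ^ (m - 1)) = 1"
    using assms(2) by simp
  then have nz: "?P \<noteq> 0"
    by (metis coeff_0 zero_neq_one)
  have "q ^ m \<le> degree ?P"
    using card_poly_roots_bound[OF nz] unfolding roots card .
  also have "\<dots> \<le> q ^ (m - 1)"
    using assms(1)
    by (intro degree_sum_le) (auto simp: degree_monom_eq intro!: power_increasing)
  also have "\<dots> < q ^ m"
    using assms(1,2) by (intro power_strict_increasing) auto
  finally show False
    by simp
qed

lemma field_Tr_scale:
  fixes K :: "'a::{field, finite} set"
  assumes K: "is_subfield K" and a: "a \<in> K"
  shows "field_Tr (card K) m (a * x) = a * field_Tr (card K) m x"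
proof -
  have "a ^ (card K ^ i) = a" for i
    by (induction i) (simp_all add: power_mult subfield_power_card[OF K a])
  then show ?thesis
    by (simp add: field_Tr_def power_mult_distrib sum_distrib_left)
qed

lemma field_Tr_add:
  fixes x y :: "'a::{field, finite}"
  assumes "prime CHAR('a)" and "q = CHAR('a) ^ n"
  shows "field_Tr q m (x + y) = field_Tr q m x + field_Tr q m y"
proof -
  have "(x + y) ^ (q ^ i) = x ^ (q ^ i) + y ^ (q ^ i)" for i
    using assms by (intro freshmans_dream'[where n = "n * i"]) (auto simp: power_mult)
  then show ?thesis
    by (simp add: field_Tr_def sum.distrib)
qed

text \<open>Raising to the power \<open>card K\<close> permutes the conjugates cyclically, so it
  fixes the trace; its fixed points are exactly \<open>K\<close>.\<close>

lemma field_Tr_in_subfield: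
  fixes K :: "'a::{field, finite} set"
  assumes K: "is_subfield K" and "prime CHAR('a)" and q: "card K = CHAR('a) ^ n"
    and card: "card (UNIV :: 'a set) = card K ^ m"
  shows "field_Tr (card K) m x \<in> K"
proof -
  let ?q = "card K"
  have frob: "x ^ (?q ^ m) = x"
    using subfield_power_card[OF is_subfield_UNIV, of x] by (simp add: card)
  have "field_Tr ?q m x ^ ?q = (\<Sum>i<m. (x ^ (?q ^ i)) ^ ?q)"
    unfolding field_Tr_def using assms(2) q by (rule freshmans_dream_sum')
  also have "\<dots> = (\<Sum>i<m. x ^ (?q ^ Suc i))"
    by (simp add: mult.commute flip: power_mult)
  also have "\<dots> = field_Tr ?q m x"
    using sum.lessThan_Suc_shift[of "\<lambda>i. x ^ (?q ^ i)" m]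
      sum.lessThan_Suc[of "\<lambda>i. x ^ (?q ^ i)" m] frob
    by (simp add: field_Tr_def)
  finally show ?thesis
    by (simp add: power_card_eq_self_iff[OF K])
qed


lemma real_card_Collect_eq_sum:
  "finite A \<Longrightarrow> real (card {x\<in>A. P x}) = (\<Sum>x\<in>A. if P x then 1 else 0)"
  using sum.inter_filter[of A "\<lambda>_. 1 :: real" P] by simp


section \<open>Hyperplanes of a nondegenerate trace form\<close>

text \<open>Any nonzero \<open>K\<close>-linear functional serves as the trace from here on. The
  cardinalities are real numbers so that \<open>n / q\<close> is an exact quotient.\<close>

locale trace_form =
  fixes K :: "'a::{field, finite} set" and q :: real and T :: "'a \<Rightarrow> 'a" and n :: real
  assumes subfield: "is_subfield K"
    and q_eq: "q = real (card K)"
    and n_eq: "n = real (card (UNIV :: 'a set))"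
    and T_add: "T (x + y) = T x + T y"
    and T_scale: "a \<in> K \<Longrightarrow> T (a * x) = a * T x"
    and T_in: "T x \<in> K"
    and T_nonzero: "\<exists>x. T x \<noteq> 0"
begin

lemmas K_closed = is_subfieldD[OF subfield]

lemma q_gt_1: "q > 1"
  using subfield_card_gt_1[OF subfield] by (simp add: q_eq)

lemma n_pos: "n > 0"
  by (simp add: n_eq card_gt_0_iff)

lemma T_0 [simp]: "T 0 = 0"
  using T_add[of 0 0] by (metis add.right_neutral add_left_cancel)

lemma T_minus: "T (- x) = - T x"
  using T_add[of x "- x"] by (simp add: eq_neg_iff_add_eq_0 add.commute)

lemma T_diff: "T (x - y) = T x - T y"
  using T_add[of x "- y"] by (simp add: T_minus)

lemma T_surj:
  assumes "v \<noteq> 0" and "t \<in> K"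
  shows "\<exists>x. T (v * x) = t"
proof -
  obtain y where y: "T y \<noteq> 0"
    using T_nonzero by blast
  have "T (v * ((t / T y) * y / v)) = T ((t / T y) * y)"
    using assms(1) by simp
  also have "\<dots> = t"
    using y assms(2) K_closed T_in by (subst T_scale) auto
  finally show ?thesis
    by blast
qed

definition H :: "'a \<Rightarrow> 'a set" where
  "H v = {x. T (v * x) = 0}"

text \<open>Every fibre is a translate of the kernel \<open>H v\<close>.\<close>

lemma card_fibre:
  assumes "v \<noteq> 0" and "t \<in> K"
  shows "card {x. T (v * x) = t} = card (H v)"
proof -
  obtain x0 where x0: "T (v * x0) = t"
    using T_surj[OF assms] by blast
  have "bij_betw (\<lambda>x. x + x0) (H v) {x. T (v * x) = t}"
    by (rule bij_betw_byWitness[where f' = "\<lambda>x. x - x0"])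
      (auto simp: H_def x0 T_add T_diff algebra_simps)
  then show ?thesis
    by (simp add: bij_betw_same_card)
qed

lemma card_eq_sum_fibres: "real (card A) = (\<Sum>t\<in>K. real (card {x\<in>A. T (v * x) = t}))"
proof -
  have "card A = card (\<Union>t\<in>K. {x\<in>A. T (v * x) = t})"
    using T_in by (intro arg_cong[where f = card]) auto
  also have "\<dots> = (\<Sum>t\<in>K. card {x\<in>A. T (v * x) = t})"
    by (rule card_UN_disjoint) auto
  finally show ?thesis
    by simp
qed

lemma card_H:
  assumes "v \<noteq> 0"
  shows "real (card (H v)) = n / q"
proof -
  have "n = (\<Sum>t\<in>K. real (card (H v)))"
    using card_eq_sum_fibres[of UNIV v] card_fibre[OF assms] by (simp add: n_eq)
  also have "\<dots> = q * real (card (H v))"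
    by (simp add: q_eq)
  finally show ?thesis
    using q_gt_1 by (simp add: field_simps)
qed

text \<open>
  Each vector outside \<open>H v\<close> lies on exactly one of the hyperplanes \<open>H (w - a * v)\<close>, \<open>a \<in> K\<close>, and
  each vector of \<open>H v\<close> on all or none of them.
\<close>
lemma card_H_Int:
  assumes v: "v \<noteq> 0" and w: "\<And>a. a \<in> K \<Longrightarrow> w \<noteq> a * v"
  shows "real (card (H v \<inter> H w)) = n / q\<^sup>2"
proof -
  have T_comb: "T ((w - a * v) * x) = T (w * x) - a * T (v * x)" if "a \<in> K" for a x
    using T_diff[of "w * x" "a * (v * x)"] T_scale[OF that, of "v * x"] by (simp add: algebra_simps)
  have count: "real (card {a\<in>K. x \<in> H (w - a * v)}) =
      (if x \<in> H v then if x \<in> H w then q else 0 else 1)" for x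
  proof (cases "x \<in> H v")
    case True
    then have "{a\<in>K. x \<in> H (w - a * v)} = (if x \<in> H w then K else {})"
      by (auto simp: H_def T_comb)
    then show ?thesis
      using True by (simp add: q_eq)
  next
    case False
    have "a \<in> K \<and> x \<in> H (w - a * v) \<longleftrightarrow> a = T (w * x) / T (v * x)" for a
    proof (cases "a \<in> K")
      case True
      then show ?thesis
        using False by (auto simp: H_def T_comb eq_divide_eq)
    next
      case False
      then show ?thesis
        using K_closed(7)[OF T_in T_in] by auto
    qed
    then have "{a\<in>K. x \<in> H (w - a * v)} = {T (w * x) / T (v * x)}"
      by auto
    then show ?thesis
      using False by simp
  qed
  \<comment> \<open>Double counting of the pairs \<open>(a, x)\<close> with
    \<open>x \<in> H (w - a * v)\<close>.\<close>
  have "(\<Sum>a\<in>K. n / q) = (\<Sum>a\<in>K. real (card (H (w - a * v))))"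
    using w by (intro sum.cong refl card_H[symmetric]) auto
  also have "\<dots> = (\<Sum>a\<in>K. \<Sum>x\<in>UNIV. if x \<in> H (w - a * v) then 1 else 0)"
    by (simp flip: real_card_Collect_eq_sum)
  also have "\<dots> = (\<Sum>x\<in>UNIV. \<Sum>a\<in>K. if x \<in> H (w - a * v) then 1 else 0)"
    by (rule sum.swap)
  also have "\<dots> = (\<Sum>x\<in>UNIV. real (card {a\<in>K. x \<in> H (w - a * v)}))"
    by (simp only: real_card_Collect_eq_sum[of K] finite)
  also have "\<dots> = (\<Sum>x\<in>UNIV. (if x \<in> H v \<inter> H w then q else 0) + (if x \<in> H v then 0 else 1))"
    unfolding count by (intro sum.cong) auto
  also have "\<dots> = q * real (card (H v \<inter> H w)) + real (card (- H v))"
    unfolding sum.distrib by (simp add: sum.If_cases Compl_eq flip: Int_def)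
  also have "real (card (- H v)) = n - n / q"
    using card_H[OF v] by (simp add: Compl_eq_Diff_UNIV card_Diff_subset n_eq card_mono)
  finally have "q * (n / q) = q * real (card (H v \<inter> H w)) + (n - n / q)"
    by (simp add: q_eq)
  then show ?thesis
    using q_gt_1 by (simp add: field_simps power2_eq_square)
qed

lemma H_scale: "a \<in> K \<Longrightarrow> a \<noteq> 0 \<Longrightarrow> H (a * v) = H v"
  by (simp add: H_def T_scale mult.assoc)

text \<open>For independent vectors the intersection has only \<open>n / q\<^sup>2\<close> elements,
  fewer than \<open>H v\<close>.\<close>

lemma H_subset_imp_multiple:
  assumes "v \<noteq> 0" and "H v \<subseteq> H w"
  shows "\<exists>a\<in>K. w = a * v"
proof (rule ccontr)
  assume "\<not> ?thesis"
  then have "n / q\<^sup>2 = n / q"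
    using card_H_Int[of v w] card_H[of v] assms by (auto simp: Int_absorb2)
  then show False
    using q_gt_1 n_pos by (simp add: field_simps power2_eq_square)
qed

lemma card_H_Diff:
  assumes "v \<noteq> 0" and "\<And>a. a \<in> K \<Longrightarrow> w \<noteq> a * v"
  shows "real (card (H v - H w)) = n / q - n / q\<^sup>2"
  using card_H_Int[of v w] card_H[of v] assms
  by (simp add: card_Diff_subset_Int card_mono)

end


section \<open>Hyperplane sections of an invariant partial difference set\<close>

text \<open>Assumption \<open>common\<close> is the strongly regular condition at the vertices 0 and
  \<open>z\<close>, read as the number of ways to write \<open>z\<close> as a sum of two elements of
  \<open>D\<close>.\<close>

locale invariant_pds = trace_form +
  fixes D :: "'a::{field, finite} set" and s r \<epsilon> k l \<mu> :: real
  assumes D_scale: "a \<in> K \<Longrightarrow> a \<noteq> 0 \<Longrightarrow> x \<in> D \<Longrightarrow> a * x \<in> D"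
    and zero_notin_D: "0 \<notin> D"
    and k_eq_card: "k = real (card D)"
    and common: "z \<noteq> 0 \<Longrightarrow> real (card {d\<in>D. z - d \<in> D}) = (if z \<in> D then l else \<mu>)"
    and s_pos: "s > 0" and n_eq_s: "n = s\<^sup>2"
    and \<epsilon>: "\<epsilon> = 1 \<or> \<epsilon> = -1"
    and k_eq: "k = r * (s - \<epsilon>)"
    and l_eq: "l = \<epsilon> * s + r\<^sup>2 - 3 * \<epsilon> * r"
    and \<mu>_eq: "\<mu> = r\<^sup>2 - \<epsilon> * r"
begin

lemma D_minus_iff: "- x \<in> D \<longleftrightarrow> x \<in> D"
  using D_scale[of "-1" x] D_scale[of "-1" "-x"] K_closed by auto

definition N :: "'a \<Rightarrow> real" where
  "N v = real (card (D \<inter> H v))"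

text \<open>
  For \<open>v \<noteq> 0\<close> this is the value of a nontrivial character sum over \<open>D\<close>, that is, an eigenvalue of
  the Cayley graph.
\<close>
definition \<theta> :: "'a \<Rightarrow> real" where
  "\<theta> v = (q * N v - k) / (q - 1)"

lemma N_eq: "q * N v = k + (q - 1) * \<theta> v"
  using q_gt_1 by (simp add: \<theta>_def)

lemma card_D_Diff_H: "real (card (D - H v)) = k - N v"
  by (simp add: N_def k_eq_card card_Diff_subset_Int card_mono)

text \<open>Scalars permute the nonzero values of the functional and preserve \<open>D\<close>, so
  the points of \<open>D\<close> off \<open>H v\<close> are shared equally among
  \<open>q - 1\<close> fibres.\<close>

lemma card_D_fibre:
  assumes "t \<in> K" and "t \<noteq> 0"
  shows "(q - 1) * real (card {x\<in>D. T (v * x) = t}) = k - N v"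
proof -
  let ?F = "\<lambda>t. {x\<in>D. T (v * x) = t}"
  have fibre_1: "card (?F u) = card (?F 1)" if u: "u \<in> K" "u \<noteq> 0" for u
  proof -
    have T_u: "T (v * (a * x)) = a * T (v * x)" if "a \<in> K" for a x
      using T_scale[OF that, of "v * x"] by (simp add: mult.left_commute)
    have "inverse u \<in> K"
      using u K_closed by simp
    then have "bij_betw (\<lambda>x. u * x) (?F 1) (?F u)"
      using u D_scale T_u by (intro bij_betw_byWitness[where f' = "\<lambda>x. inverse u * x"]) auto
    then show ?thesis
      by (simp add: bij_betw_same_card)
  qed
  have "k = (\<Sum>u\<in>K. real (card (?F u)))"
    unfolding k_eq_card by (rule card_eq_sum_fibres)
  also have "\<dots> = real (card (?F 0)) + (\<Sum>u\<in>K - {0}. real (card (?F u)))"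
    using K_closed by (simp add: sum.remove)
  also have "?F 0 = D \<inter> H v"
    by (auto simp: H_def)
  also have "(\<Sum>u\<in>K - {0}. real (card (?F u))) = (\<Sum>u\<in>K - {0}. real (card (?F t)))"
    using fibre_1 assms by (intro sum.cong refl) auto
  also have "\<dots> = (q - 1) * real (card (?F t))"
    using K_closed subfield_card_gt_1[OF subfield] by (simp add: q_eq card_Diff_subset)
  finally show ?thesis
    by (simp add: N_def)
qed

text \<open>Both sides count the pairs in \<open>D \<times> D\<close> whose sum lies on the hyperplane \<open>H v\<close>.\<close>
lemma N_quadratic:
  assumes "v \<noteq> 0"
  shows "(q - 1) * (k + l * N v + \<mu> * (n / q - 1 - N v)) = (q - 1) * (N v)\<^sup>2 + (k - N v)\<^sup>2"
proof -
  let ?c = "(k - N v) / (q - 1)"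
  have H_0: "0 \<in> H v"
    by (simp add: H_def)
  \<comment> \<open>For fixed \<open>d\<close>, the partner \<open>z - d\<close> runs through the
    points of \<open>D\<close> where the functional takes the value
    \<open>- T (v * d)\<close>.\<close>
  have row: "real (card {z\<in>H v. z - d \<in> D}) = (if d \<in> H v then N v else ?c)" for d
  proof -
    have "bij_betw (\<lambda>x. x + d) {x\<in>D. T (v * x) = - T (v * d)} {z\<in>H v. z - d \<in> D}"
      by (rule bij_betw_byWitness[where f' = "\<lambda>x. x - d"])
        (auto simp: H_def T_add T_diff algebra_simps)
    then have eq: "card {z\<in>H v. z - d \<in> D} = card {x\<in>D. T (v * x) = - T (v * d)}"
      by (simp add: bij_betw_same_card)
    show ?thesis
    proof (cases "d \<in> H v")
      case True
      then show ?thesis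
        unfolding eq by (simp add: N_def H_def Int_def)
    next
      case False
      then show ?thesis
        unfolding eq using card_D_fibre[of "- T (v * d)" v] K_closed T_in q_gt_1
        by (simp add: H_def field_simps)
    qed
  qed
  \<comment> \<open>At \<open>z = 0\<close> each \<open>d\<close> pairs with \<open>- d\<close>,
    which contributes \<open>k\<close>; all other sums are governed by
    \<open>common\<close>.\<close>
  have "{d\<in>D. 0 - d \<in> D} = D"
    by (auto simp: D_minus_iff)
  then have col: "real (card {d\<in>D. z - d \<in> D}) =
      (if z = 0 then k else 0) + (if z \<in> D then l else 0) + (if z \<in> - (D \<union> {0}) then \<mu> else 0)" for z
    using common[of z] zero_notin_D by (auto simp: k_eq_card)
  have card_rest: "real (card (H v \<inter> - (D \<union> {0}))) = n / q - 1 - N v"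
  proof -
    have "H v \<inter> - (D \<union> {0}) = H v - insert 0 (D \<inter> H v)"
      by auto
    moreover have "insert 0 (D \<inter> H v) \<subseteq> H v"
      using H_0 by auto
    ultimately have "real (card (H v \<inter> - (D \<union> {0}))) =
        real (card (H v)) - real (card (insert 0 (D \<inter> H v)))"
      by (simp add: card_Diff_subset card_mono del: card_insert_disjoint)
    then show ?thesis
      using card_H[OF assms] zero_notin_D by (simp add: N_def)
  qed
  have compl: "{z. z \<noteq> 0 \<and> z \<notin> D} = - insert 0 D"
    by auto
  have "k + l * N v + \<mu> * (n / q - 1 - N v) = (\<Sum>z\<in>H v. real (card {d\<in>D. z - d \<in> D}))"
    unfolding col sum.distrib using H_0 card_rest compl
    by (simp add: sum.If_cases N_def Int_commute)
  also have "\<dots> = (\<Sum>z\<in>H v. \<Sum>d\<in>D. if z - d \<in> D then 1 else 0)"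
    by (simp add: real_card_Collect_eq_sum)
  also have "\<dots> = (\<Sum>d\<in>D. \<Sum>z\<in>H v. if z - d \<in> D then 1 else 0)"
    by (rule sum.swap)
  also have "\<dots> = (\<Sum>d\<in>D. real (card {z\<in>H v. z - d \<in> D}))"
    by (simp add: real_card_Collect_eq_sum)
  also have "\<dots> = N v * N v + (k - N v) * ?c"
    unfolding row using card_D_Diff_H[of v]
    by (simp add: sum.If_cases N_def Diff_eq)
  finally show ?thesis
    using q_gt_1 by (simp add: field_simps power2_eq_square)
qed

text \<open>\<open>N v\<close> is affine in \<open>\<theta> v\<close>, so \<open>N_quadratic\<close>
  becomes a quadratic equation for the eigenvalue, which factors for the given parameters because
  \<open>\<epsilon>\<^sup>2 = 1\<close>.\<close>

lemma \<theta>_cases: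
  assumes "v \<noteq> 0"
  shows "\<theta> v = \<epsilon> * (s - r) \<or> \<theta> v = - \<epsilon> * r"
proof -
  define t where "t = \<theta> v"
  have N: "N v = (k + (q - 1) * t) / q"
    using N_eq[of v] q_gt_1 by (simp add: t_def field_simps)
  have "(q - 1) * (q * k + l * (k + (q - 1) * t) + \<mu> * (s\<^sup>2 - q - (k + (q - 1) * t)))
      = (q - 1) * (k\<^sup>2 + (q - 1) * t\<^sup>2)"
  proof -
    have "q * ((q - 1) * (q * k + l * (k + (q - 1) * t) + \<mu> * (s\<^sup>2 - q - (k + (q - 1) * t))))
       = q\<^sup>2 * ((q - 1) * (k + l * N v + \<mu> * (n / q - 1 - N v)))"
      using q_gt_1 by (simp add: N n_eq_s field_simps power2_eq_square)
    also have "\<dots> = q\<^sup>2 * ((q - 1) * (N v)\<^sup>2 + (k - N v)\<^sup>2)"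
      by (simp only: N_quadratic[OF assms])
    also have "\<dots> = (q - 1) * (q * N v)\<^sup>2 + (q * k - q * N v)\<^sup>2"
      by (simp add: power2_eq_square algebra_simps)
    also have "q * N v = k + (q - 1) * t"
      by (simp add: N_eq t_def)
    also have "(q - 1) * (k + (q - 1) * t)\<^sup>2 + (q * k - (k + (q - 1) * t))\<^sup>2
       = q * ((q - 1) * (k\<^sup>2 + (q - 1) * t\<^sup>2))"
      by (simp add: power2_eq_square algebra_simps)
    finally show ?thesis
      using q_gt_1 by simp
  qed
  then have "q * k + l * (k + (q - 1) * t) + \<mu> * (s\<^sup>2 - q - (k + (q - 1) * t))
      = k\<^sup>2 + (q - 1) * t\<^sup>2"
    using q_gt_1 by simp
  then have "(q - 1) * ((t - \<epsilon> * (s - r)) * (t + \<epsilon> * r)) = 0"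
    using \<epsilon> unfolding k_eq l_eq \<mu>_eq by (auto simp: power2_eq_square algebra_simps)
  then show ?thesis
    using q_gt_1 by (auto simp: t_def)
qed

end


section \<open>Eigenvalue estimates in the two parameter regimes, and support inclusion\<close>

locale large_invariant_pds = invariant_pds +
  assumes s_large: "q\<^sup>2 \<le> s" and s_ge_8: "q = 2 \<Longrightarrow> 8 \<le> s"
    and k_less: "k < n - 1" and r_pos: "r > 0"
    and regime: "(\<epsilon> = 1 \<and> r \<noteq> s \<and> r > 1) \<or>
      (\<epsilon> = -1 \<and> r \<noteq> s - 1 \<and> r > (q - 1) * s / (s + q))"
begin

lemma q_less_s: "q < s"
proof -
  have "q * 1 < q * q"
    using q_gt_1 by (intro mult_strict_left_mono) auto
  then show ?thesis
    using s_large unfolding power2_eq_square by linarith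
qed

text \<open>Cancel \<open>s - \<epsilon>\<close> in \<open>k < n - 1\<close>, where
  \<open>n - 1 = (s + \<epsilon>) * (s - \<epsilon>)\<close>.\<close>

lemma r_less: "r < s + \<epsilon>"
proof -
  have "r * (s - \<epsilon>) < (s + \<epsilon>) * (s - \<epsilon>)"
    using k_less \<epsilon> by (auto simp: k_eq n_eq_s power2_eq_square algebra_simps)
  moreover have "s - \<epsilon> > 0"
    using \<epsilon> q_less_s q_gt_1 by auto
  ultimately show ?thesis
    by simp
qed

text \<open>Positivity of \<open>k + (q - 1) * \<theta> v\<close> is checked at both eigenvalues.
  For \<open>\<epsilon> = -1\<close> and the eigenvalue \<open>r - s\<close> it says
  \<open>r * (s + q) > (q - 1) * s\<close>, which is precisely the lower bound on
  \<open>r\<close>.\<close>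

lemma N_pos:
  assumes "v \<noteq> 0"
  shows "N v > 0"
proof -
  have r_s: "r * q < r * s"
    using r_pos q_less_s by simp
  have qs: "(q - 1) * s > 0"
    using q_gt_1 s_pos by simp
  have "r * (s - \<epsilon>) + (q - 1) * t > 0" if t: "t = \<epsilon> * (s - r) \<or> t = - \<epsilon> * r" for t
    using regime
  proof (elim disjE conjE)
    assume "\<epsilon> = 1"
    then show ?thesis
      using t r_s qs by (auto simp: algebra_simps)
  next
    assume \<epsilon>: "\<epsilon> = -1" and r: "r > (q - 1) * s / (s + q)"
    have "r * (s + q) > (q - 1) * s"
      using r q_gt_1 s_pos by (simp add: divide_less_eq)
    then show ?thesis
      using \<epsilon> t mult_pos_pos[OF r_pos s_pos] mult_pos_pos[OF r_pos, of q] q_gt_1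
      by (auto simp: algebra_simps)
  qed
  then have "q * N v > 0"
    unfolding N_eq k_eq[symmetric] using \<theta>_cases[OF assms] by blast
  then show ?thesis
    using q_gt_1 by (simp add: zero_less_mult_iff)
qed

lemma k_minus_\<theta>:
  assumes "v \<noteq> 0"
  shows "k - \<theta> v = (r - \<epsilon>) * s \<or> k - \<theta> v = r * s"
proof -
  have "r * (s - \<epsilon>) - t = (r - \<epsilon>) * s \<or> r * (s - \<epsilon>) - t = r * s"
    if "t = \<epsilon> * (s - r) \<or> t = - \<epsilon> * r" for t
    using that \<epsilon> by (auto simp: algebra_simps)
  then show ?thesis
    unfolding k_eq[symmetric] using \<theta>_cases[OF assms] by blast
qed

text \<open>Value 0 would mean that \<open>D\<close> lies inside \<open>H v\<close>, value
  \<open>n\<close> that \<open>D\<close> contains everything outside \<open>H v\<close>.\<close>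

lemma k_minus_\<theta>_nontrivial:
  assumes "v \<noteq> 0"
  shows "k - \<theta> v \<noteq> 0" and "k - \<theta> v \<noteq> n"
proof -
  have "r \<noteq> \<epsilon>" "r \<noteq> 0" "r - \<epsilon> \<noteq> s" "r \<noteq> s"
    using regime r_pos r_less by auto
  then have "t \<noteq> 0 \<and> t \<noteq> n" if "t = (r - \<epsilon>) * s \<or> t = r * s" for t
    using that s_pos by (auto simp: n_eq_s power2_eq_square)
  then show "k - \<theta> v \<noteq> 0" "k - \<theta> v \<noteq> n"
    using k_minus_\<theta>[OF assms] by blast+
qed

lemma card_D_Diff_H_\<theta>: "q * real (card (D - H w)) = (q - 1) * (k - \<theta> w)"
  using N_eq[of w] by (simp add: card_D_Diff_H algebra_simps)

lemma \<theta>_diff_le: "v \<noteq> 0 \<Longrightarrow> w \<noteq> 0 \<Longrightarrow> \<theta> v - \<theta> w \<le> s"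
  using \<theta>_cases[of v] \<theta>_cases[of w] \<epsilon> s_pos by auto

text \<open>Otherwise \<open>D\<close> and \<open>H v\<close> agree off \<open>H w\<close>. If
  \<open>v\<close> is a multiple of \<open>w\<close>, then \<open>D\<close> contains all or none of
  the points off \<open>H w\<close>; if not, two eigenvalues would differ by
  \<open>s\<^sup>2 / q\<close>, which exceeds \<open>s\<close>.\<close>

lemma not_hyperplane_off_hyperplane:
  assumes w: "w \<noteq> 0"
  shows "\<exists>x. T (w * x) \<noteq> 0 \<and> (x \<in> D \<longleftrightarrow> T (v * x) \<noteq> 0)"
proof (rule ccontr)
  assume "\<not> ?thesis"
  then have off: "x \<in> D \<longleftrightarrow> x \<in> H v" if "x \<notin> H w" for x
    using that by (auto simp: H_def)
  then have D_H: "D - H w = H v - H w"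
    by auto
  have key: "q * real (card (H v - H w)) = (q - 1) * (k - \<theta> w)"
    using card_D_Diff_H_\<theta>[of w] by (simp add: D_H)
  consider "v = 0" | a where "a \<in> K" "a \<noteq> 0" "v = a * w" | "\<And>a. a \<in> K \<Longrightarrow> v \<noteq> a * w"
    by (metis mult_zero_left)
  then show False
  proof cases
    case 1
    then have "real (card (H v - H w)) = n - n / q"
      using card_H[OF w] by (simp add: H_def card_Diff_subset n_eq card_mono)
    then have "(q - 1) * n = (q - 1) * (k - \<theta> w)"
      using key q_gt_1 by (simp add: field_simps)
    then show False
      using k_minus_\<theta>_nontrivial(2)[OF w] q_gt_1 by simp
  next
    case 2
    then have "H v = H w"
      by (simp add: H_scale)
    then show False
      using key k_minus_\<theta>_nontrivial(1)[OF w] q_gt_1 by simp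
  next
    case 3
    have v: "v \<noteq> 0"
      using 3[of 0] K_closed by simp
    have vw: "v + w \<noteq> 0"
      using 3[of "-1"] K_closed by (auto simp: eq_neg_iff_add_eq_0)
    have "w \<noteq> a * v" if "a \<in> K" for a
      using 3[of "inverse a"] w that K_closed by (cases "a = 0") auto
    then have diff: "real (card (H v - H w)) = n / q - n / q\<^sup>2"
      by (rule card_H_Diff[OF v])
    have T_vw: "T ((v + w) * x) = T (v * x) + T (w * x)" for x
      using T_add[of "v * x" "w * x"] by (simp add: algebra_simps)
    \<comment> \<open>On \<open>H w\<close> the hyperplanes of \<open>v\<close> and
      \<open>v + w\<close> coincide; off \<open>H w\<close> they are disjoint and \<open>D\<close>
      follows \<open>H v\<close>.\<close>
    have "x \<in> D \<inter> H v \<longleftrightarrow> x \<in> (H v - H w) \<union> (D \<inter> H (v + w))" for x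
      using off[of x] by (cases "x \<in> H w") (auto simp: H_def T_vw)
    then have "D \<inter> H v = (H v - H w) \<union> (D \<inter> H (v + w))" "(H v - H w) \<inter> (D \<inter> H (v + w)) = {}"
      by (auto simp: H_def T_vw)
    then have "N v = real (card (H v - H w)) + N (v + w)"
      by (simp add: N_def card_Un_disjoint)
    then have "N v - N (v + w) = n / q - n / q\<^sup>2"
      by (simp add: diff)
    then have "q * N v - q * N (v + w) = q * (n / q - n / q\<^sup>2)"
      by (simp flip: right_diff_distrib)
    also have "\<dots> = (q - 1) * (s\<^sup>2 / q)"
      using q_gt_1 by (simp add: n_eq_s field_simps power2_eq_square)
    finally have "(q - 1) * (\<theta> v - \<theta> (v + w)) = (q - 1) * (s\<^sup>2 / q)"
      unfolding N_eq by (simp add: algebra_simps)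
    then have "\<theta> v - \<theta> (v + w) = s\<^sup>2 / q"
      using q_gt_1 by (metis diff_gt_0_iff_gt less_irrefl mult_left_cancel)
    then have "s\<^sup>2 / q \<le> s"
      using \<theta>_diff_le[OF v vw] by simp
    then show False
      using q_less_s q_gt_1 s_pos by (simp add: power2_eq_square divide_le_eq)
  qed
qed

text \<open>
  Homogeneity of \<open>D\<close> settles the claim unless \<open>K\<close> has two elements; then \<open>D\<close> would meet \<open>H v\<close> in
  an affine hyperplane of \<open>H v\<close>, and counting \<open>D\<close> along \<open>H v\<close>, \<open>H w\<close>, \<open>H (v + w)\<close> makes an
  eigenvalue too negative.
\<close>
lemma section_nonlinear:
  assumes v: "v \<noteq> 0" and u: "u \<in> K"
    and lin: "\<And>x. T (v * x) = 0 \<Longrightarrow> u * char_fun D x + T (w * x) = 0"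
  shows "u = 0"
proof (rule ccontr)
  assume u_nz: "u \<noteq> 0"
  have T_mult: "T (y * (a * x)) = a * T (y * x)" if "a \<in> K" for a x y
    using T_scale[OF that, of "y * x"] by (simp add: mult.left_commute)
  have "D \<inter> H v \<noteq> {}"
    using N_pos[OF v] by (auto simp: N_def)
  then obtain x where x: "x \<in> D" "T (v * x) = 0"
    by (auto simp: H_def)
  \<comment> \<open>Passing from \<open>x\<close> to \<open>a * x\<close> scales the trace term but
    leaves the characteristic function at 1.\<close>
  have "a = 1" if a: "a \<in> K" "a \<noteq> 0" for a
  proof -
    have "u + T (w * x) = 0" "u + a * T (w * x) = 0"
      using lin[of x] lin[of "a * x"] x D_scale[OF a x(1)] a by (auto simp: T_mult char_fun_def)
    moreover have "(a - 1) * T (w * x) = (u + a * T (w * x)) - (u + T (w * x))"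
      by (simp add: algebra_simps)
    ultimately have "(a - 1) * T (w * x) = 0" "T (w * x) \<noteq> 0"
      using u_nz by auto
    then show ?thesis
      by simp
  qed
  then have "K = {0, 1}"
    using K_closed by auto
  then have q: "q = 2"
    by (simp add: q_eq)
  have bit: "t = 0 \<or> t = 1" if "t \<in> K" for t
    using that \<open>K = {0, 1}\<close> by auto
  have u1: "u = 1"
    using bit[OF u] u_nz by simp
  have char2: "(1 :: 'a) + 1 = 0"
    using bit[of "1 + 1"] K_closed(2,3) by (metis add_cancel_left_right zero_neq_one)
  have T_bit: "T y = 0 \<or> T y = 1" for y
    using bit T_in by auto
  have D_iff: "x \<in> D \<longleftrightarrow> x \<notin> H w" if "x \<in> H v" for x
    using lin[of x] that T_bit[of "w * x"] u1 char2
    by (cases "x \<in> D") (auto simp: H_def char_fun_def)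
  have w: "w \<noteq> a * v" if "a \<in> K" for a
  proof
    assume "w = a * v"
    then have "T (w * x) = 0"
      using T_mult[OF that, of v x] x by (simp add: algebra_simps)
    then show False
      using D_iff x by (auto simp: H_def)
  qed
  have w0: "w \<noteq> 0" and vw: "v + w \<noteq> 0"
    using w[of 0] w[of "-1"] K_closed by (auto simp: eq_neg_iff_add_eq_0 add.commute)
  have T_vw: "T ((v + w) * x) = T (v * x) + T (w * x)" for x
    using T_add[of "v * x" "w * x"] by (simp add: algebra_simps)
  have "D \<inter> H v = H v - H w"
    using D_iff by auto
  then have Nv: "N v = s\<^sup>2 / 4"
    using card_H_Diff[OF v w] by (simp add: N_def q n_eq_s)
  \<comment> \<open>Off \<open>H v\<close>, with only two scalars, exactly one of
    \<open>T (w * x)\<close> and \<open>T ((v + w) * x)\<close> vanishes.\<close>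
  have "x \<in> D - H v \<longleftrightarrow> x \<in> (D \<inter> H w) \<union> (D \<inter> H (v + w))" for x
    using D_iff[of x] T_bit[of "v * x"] T_bit[of "w * x"] char2 by (auto simp: H_def T_vw)
  moreover have "x \<notin> (D \<inter> H w) \<inter> (D \<inter> H (v + w))" for x
    using D_iff[of x] by (auto simp: H_def T_vw)
  ultimately have "D - H v = (D \<inter> H w) \<union> (D \<inter> H (v + w))" "(D \<inter> H w) \<inter> (D \<inter> H (v + w)) = {}"
    by blast+
  then have "real (card (D - H v)) = N w + N (v + w)"
    by (simp add: N_def card_Un_disjoint)
  then have "N v + N w + N (v + w) = k"
    by (simp add: card_D_Diff_H)
  moreover have "2 * N y = k + \<theta> y" for y
    using N_eq[of y] by (simp add: q)
  note this[of v] this[of w] this[of "v + w"]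
  ultimately have "\<theta> w + \<theta> (v + w) = - (s\<^sup>2 / 2)"
    using Nv by linarith
  \<comment> \<open>Two eigenvalues sum to at least \<open>- 2 * (s + 1)\<close>, which is greater
    than \<open>- (s\<^sup>2 / 2)\<close> once \<open>s \<ge> 8\<close>.\<close>
  moreover have "t \<ge> - (s + 1)" if "t = \<epsilon> * (s - r) \<or> t = - \<epsilon> * r" for t
    using that \<epsilon> r_less r_pos s_pos by auto
  note this[OF \<theta>_cases[OF w0]] this[OF \<theta>_cases[OF vw]]
  moreover have "s\<^sup>2 \<ge> 8 * s"
    using s_ge_8[OF q] s_pos by (simp add: power2_eq_square)
  ultimately show False
    using s_ge_8[OF q] by linarith
qed

text \<open>Minimality with words replaced by functions on the whole field, independent of the
  ordering of coordinates.\<close>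

lemma support_minimal:
  assumes u: "u \<in> K" and u': "u' \<in> K"
    and supp: "\<And>x. x \<noteq> 0 \<Longrightarrow> u * char_fun D x + T (v * x) = 0 \<Longrightarrow>
      u' * char_fun D x + T (v' * x) = 0"
  shows "\<exists>a\<in>K. \<forall>x. u' * char_fun D x + T (v' * x) = a * (u * char_fun D x + T (v * x))"
proof -
  have T_mult: "T (y * (a * x)) = a * T (y * x)" "T (a * y * x) = a * T (y * x)"
    if "a \<in> K" for a x y
    using T_scale[OF that, of "y * x"] by (simp_all add: ac_simps)
  \<comment> \<open>The point 0 is not a coordinate, but both functions vanish there.\<close>
  have supp_0: "u' * char_fun D x + T (v' * x) = 0" if "u * char_fun D x + T (v * x) = 0" for x
    using supp[of x] that zero_notin_D by (cases "x = 0") (auto simp: char_fun_def)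
  consider "u \<noteq> 0" | "u = 0" "v = 0" | "u = 0" "v \<noteq> 0"
    by blast
  then show ?thesis
  proof cases
    case 1
    define c where "c = u' / u"
    have c: "c \<in> K" "u' = c * u"
      using u u' 1 K_closed by (auto simp: c_def)
    have T_w: "T ((v' - c * v) * x) = T (v' * x) - c * T (v * x)" for x
      using T_diff[of "v' * x" "c * v * x"] T_mult(2)[OF c(1), of v x]
      by (simp add: left_diff_distrib)
    have "T ((v' - c * v) * x) = 0" if "x \<in> D \<longleftrightarrow> T (v * x) \<noteq> 0" for x
    proof (cases "x \<in> D")
      case True
      \<comment> \<open>This scalar moves \<open>x\<close> within \<open>D\<close> to a zero of the
        first function, where the support condition applies.\<close>
      define a where "a = - u / T (v * x)"
      have a: "a \<in> K" "a \<noteq> 0" "a * T (v * x) = - u"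
        using True that 1 u K_closed T_in by (auto simp: a_def)
      then have "u' + a * T (v' * x) = 0"
        using supp_0[of "a * x"] D_scale[OF a(1,2) True] by (simp add: char_fun_def T_mult)
      moreover have "a * (T (v' * x) - c * T (v * x)) = (u' + a * T (v' * x)) - c * (u + a * T (v * x))"
        by (simp add: c(2) algebra_simps)
      ultimately have "a * (T (v' * x) - c * T (v * x)) = 0"
        using a(3) by simp
      then show ?thesis
        using a(2) by (simp add: T_w)
    next
      case False
      then show ?thesis
        using that supp_0[of x] by (simp add: T_w char_fun_def)
    qed
    then have "v' - c * v = 0"
      using not_hyperplane_off_hyperplane by blast
    then have "v' = c * v"
      by simp
    then have "\<forall>x. u' * char_fun D x + T (v' * x) = c * (u * char_fun D x + T (v * x))"
      by (simp add: c(2) T_scale[OF c(1)] distrib_left mult.assoc)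
    then show ?thesis
      using c(1) by blast
  next
    case 2
    then show ?thesis
      using supp_0 K_closed by (intro bexI[of _ 0]) auto
  next
    case 3
    then have "u' = 0"
      using section_nonlinear[of v u' v'] u' supp_0 by simp
    then have "H v \<subseteq> H v'"
      using supp_0 3 by (auto simp: H_def)
    then obtain a where "a \<in> K" "v' = a * v"
      using H_subset_imp_multiple 3 by blast
    then show ?thesis
      using 3 \<open>u' = 0\<close> by (intro bexI[of _ a]) (simp_all add: T_scale mult.assoc)
  qed
qed

end


section \<open>Minimality of the code\<close>

text \<open>The vertex 0 has neighbourhood \<open>D\<close>, and since \<open>- D = D\<close> its
  common neighbours with \<open>z\<close> are the \<open>d\<close> in \<open>D\<close> with
  \<open>z - d\<close> in \<open>D\<close>.\<close>

lemma partial_difference_setD: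
  assumes "partial_difference_set D v k l mu"
  shows "card D = k"
    and "z \<noteq> 0 \<Longrightarrow> card {d\<in>D. z - d \<in> D} = (if z \<in> D then l else mu)"
proof -
  have minus: "- x \<in> D \<longleftrightarrow> x \<in> D" for x
    using assms unfolding partial_difference_set_def by (metis imageI minus_minus)
  have srg: "strongly_regular (cayley_graph D) v k l mu"
    using assms by (simp add: partial_difference_set_def)
  have nb: "neighbours (cayley_graph D) x = {y. x - y \<in> D}" for x
    by (simp add: neighbours_def cayley_graph_def)
  have nb_0: "neighbours (cayley_graph D) 0 = D"
    by (simp add: nb minus)
  have verts: "pverts (cayley_graph D) = UNIV"
    by (simp add: cayley_graph_def)
  show "card D = k"
    using srg nb_0 verts unfolding strongly_regular_def by (metis UNIV_I)
  assume z: "z \<noteq> 0"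
  have "{d\<in>D. z - d \<in> D} = neighbours (cayley_graph D) 0 \<inter> neighbours (cayley_graph D) z"
    unfolding nb by (auto simp: minus)
  moreover have "(0, z) \<in> parcs (cayley_graph D) \<longleftrightarrow> z \<in> D"
    by (simp add: cayley_graph_def minus)
  ultimately show "card {d\<in>D. z - d \<in> D} = (if z \<in> D then l else mu)"
    using srg z verts unfolding strongly_regular_def by auto
qed

text \<open>Codewords depend \<open>K\<close>-linearly on the pair \<open>(u, v)\<close>.\<close>

lemma linear_code_code_of:
  fixes K :: "'a::field set"
  assumes "is_subfield K" and "length xs = n"
    and Tr_in: "\<And>x. field_Tr q m x \<in> K"
    and Tr_add: "\<And>x y :: 'a. field_Tr q m (x + y) = field_Tr q m x + field_Tr q m y"
    and Tr_scale: "\<And>a x. a \<in> K \<Longrightarrow> field_Tr q m (a * x) = a * field_Tr q m x"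
  shows "linear_code K n (code_of K q m xs D)"
proof -
  note K = is_subfieldD[OF assms(1)]
  have "x \<in> K" if "u \<in> K" "x \<in> set (codeword q m xs D u v)" for u v x
    using that K Tr_in by (auto simp: codeword_def char_fun_def)
  moreover have "length (codeword q m xs D u v) = n" for u v
    using assms(2) by (simp add: codeword_def)
  ultimately have words: "code_of K q m xs D \<subseteq> {c. length c = n \<and> set c \<subseteq> K}"
    by (auto simp: code_of_def)
  have codeI: "codeword q m xs D u v \<in> code_of K q m xs D" if "u \<in> K" for u v
    using that by (auto simp: code_of_def)
  have zero: "replicate n 0 = codeword q m xs D 0 0"
    using Tr_scale[of 0 0] K assms(2) by (auto simp: codeword_def map_replicate_const)
  have add: "map2 (+) (codeword q m xs D u v) (codeword q m xs D u' v') =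
      codeword q m xs D (u + u') (v + v')" for u v u' v'
    by (rule nth_equalityI) (simp_all add: codeword_def Tr_add distrib_right)
  have scale: "map (\<lambda>x. a * x) (codeword q m xs D u v) = codeword q m xs D (a * u) (a * v)"
    if "a \<in> K" for a u v
    using Tr_scale[OF that] by (auto simp: codeword_def mult.assoc distrib_left)
  show ?thesis
    unfolding linear_code_def
  proof (intro conjI ballI)
    show "replicate n 0 \<in> code_of K q m xs D"
      unfolding zero by (rule codeI) (rule K(1))
  next
    fix c c'
    assume "c \<in> code_of K q m xs D" "c' \<in> code_of K q m xs D"
    then obtain u v u' v' where "u \<in> K" "u' \<in> K" "c = codeword q m xs D u v"
      "c' = codeword q m xs D u' v'"
      by (auto simp: code_of_def)
    then show "map2 (+) c c' \<in> code_of K q m xs D"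
      by (simp add: add codeI K(3))
  next
    fix a c
    assume "a \<in> K" "c \<in> code_of K q m xs D"
    then obtain u v where "u \<in> K" "c = codeword q m xs D u v"
      by (auto simp: code_of_def)
    then show "map (\<lambda>x. a * x) c \<in> code_of K q m xs D"
      using \<open>a \<in> K\<close> by (simp add: scale codeI K(4))
  qed (rule words)
qed

theorem theorem5:
  fixes p e q m r k l mu :: nat
    and eps :: int
    and K D :: "'a::{field, finite} set"
    and xs :: "'a list"
  assumes "prime p" and "e \<ge> 1" and "q = p ^ e"
    and "m \<ge> 4" and "(m, q) \<noteq> (4, 2)" and "2 dvd e * m"
    and "is_subfield K" and "card K = q" and "card (UNIV :: 'a set) = q ^ m"
    and "distinct xs" and "set xs = UNIV - {0}"
    and "eps = 1 \<or> eps = -1" and "r > 0"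
    and "D \<subset> UNIV - {0}" and "scalar_invariant K D"
    and "partial_difference_set D (q ^ m) k l mu"
    and "real k = real r * (sqrt (real (q ^ m)) - real_of_int eps)"
    and "real l = real_of_int eps * sqrt (real (q ^ m)) + (real r)\<^sup>2
           - 3 * real_of_int eps * real r"
    and "real mu = (real r)\<^sup>2 - real_of_int eps * real r"
    and "(eps = 1 \<and> real r \<noteq> sqrt (real (q ^ m)) \<and> r > 1) \<or>
         (eps = -1 \<and> real r \<noteq> sqrt (real (q ^ m)) - 1 \<and>
            real r > (real q - 1) * sqrt (real (q ^ m)) / (sqrt (real (q ^ m)) + real q))"
  shows "minimal_linear_code K (q ^ m - 1) (code_of K q m xs D)"
proof -
  define s where "s = sqrt (real (q ^ m))"
  have q_gt_1: "q > 1"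
    using subfield_card_gt_1[OF assms(7)] assms(8) by simp
  have "card (UNIV :: 'a set) = p ^ (e * m)"
    using assms(3,9) by (simp add: power_mult)
  then have CHAR: "CHAR('a) = p"
    by (rule CHAR_eq_if_card_prime_power[OF assms(1)])
  have Tr_add: "field_Tr q m (x + y) = field_Tr q m x + field_Tr q m y" for x y :: 'a
    using assms(1,3) CHAR by (intro field_Tr_add[where n = e]) auto
  have Tr_scale: "field_Tr q m (a * x) = a * field_Tr q m x" if "a \<in> K" for a x
    using field_Tr_scale[OF assms(7) that] assms(8) by simp
  have Tr_in: "field_Tr q m x \<in> K" for x
    using field_Tr_in_subfield[OF assms(7), of e m x] assms(1,3,8,9) CHAR by simp
  have s_sq: "s\<^sup>2 = real (q ^ m)"
    by (simp add: s_def)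
  \<comment> \<open>The hypothesis \<open>m \<ge> 4\<close> enters here:
    \<open>q ^ 4 \<le> q ^ m = s\<^sup>2\<close>.\<close>
  have "(real q ^ 2)\<^sup>2 = real q ^ 4"
    by (simp flip: power_mult)
  also have "\<dots> \<le> real q ^ m"
    using q_gt_1 assms(4) by (intro power_increasing) auto
  finally have s_large: "(real q)\<^sup>2 \<le> s"
    by (simp add: s_def real_le_rsqrt)
  \<comment> \<open>If \<open>q = 2\<close> then \<open>e = 1\<close>, so \<open>m\<close> is even;
    with \<open>m = 4\<close> excluded, \<open>m \<ge> 6\<close> and
    \<open>s\<^sup>2 \<ge> 64\<close>.\<close>
  have s_ge_8: "8 \<le> s" if "real q = 2"
  proof -
    have q2: "q = 2"
      using that by simp
    have "2 ^ e \<le> p ^ e"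
      using prime_ge_2_nat[OF assms(1)] by (rule power_mono) simp
    then have "2 ^ e \<le> (2 :: nat) ^ 1"
      using q2 assms(3) by simp
    then have "e \<le> 1"
      by (subst (asm) power_increasing_iff) auto
    then have "e = 1"
      using assms(2) by simp
    then have "even m"
      using assms(6) by simp
    moreover have "m \<noteq> 4" "m \<noteq> 5"
      using assms(5) q2 \<open>even m\<close> by auto
    ultimately have "6 \<le> m"
      using assms(4) by linarith
    then have "(2 :: real) ^ 6 \<le> 2 ^ m"
      by (intro power_increasing) auto
    then show ?thesis
      by (simp add: s_def q2 real_le_rsqrt)
  qed
  have "card D < card (UNIV - {0 :: 'a})"
    using assms(14) by (intro psubset_card_mono) auto
  then have k_less: "real k < real (card (UNIV :: 'a set)) - 1"
    using partial_difference_setD(1)[OF assms(16)] by (simp add: card_Diff_subset)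
  have nz: "0 \<notin> D"
    using assms(14) by auto
  interpret large_invariant_pds K q "field_Tr q m" "card (UNIV :: 'a set)" D s r eps k l mu
  proof
    show "\<exists>x :: 'a. field_Tr q m x \<noteq> 0"
      using q_gt_1 assms(4,9) by (intro field_Tr_nonzero) auto
    show "a * x \<in> D" if "a \<in> K" "a \<noteq> 0" "x \<in> D" for a x
      using assms(15) that unfolding scalar_invariant_def by blast
    show "real (card {d \<in> D. z - d \<in> D}) = (if z \<in> D then real l else real mu)" if "z \<noteq> 0" for z
      using partial_difference_setD(2)[OF assms(16) that] by simp
    show "real k = real (card D)"
      using partial_difference_setD(1)[OF assms(16)] by simp
    show "s > 0"
      using q_gt_1 by (simp add: s_def)
    show "real (card (UNIV :: 'a set)) = s\<^sup>2"
      using s_sq assms(9) by simp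
    show "real_of_int eps = 1 \<or> real_of_int eps = - 1"
      using assms(12) by auto
    show "real_of_int eps = 1 \<and> real r \<noteq> s \<and> 1 < real r \<or>
      real_of_int eps = - 1 \<and> real r \<noteq> s - 1 \<and> (real q - 1) * s / (s + real q) < real r"
      using assms(20) unfolding s_def by auto
  qed (fact assms(7) assms(17-19)[folded s_def] Tr_add Tr_scale Tr_in s_large s_ge_8 k_less nz
    | use assms(8,13) in simp)+
  have len: "length xs = q ^ m - 1"
    using distinct_card[OF assms(10)] assms(9,11) by (simp add: card_Diff_subset)
  have minimal: "\<exists>a\<in>K. c' = map (\<lambda>x. a * x) c"
    if c: "c \<in> code_of K q m xs D" "c' \<in> code_of K q m xs D" "word_supp c' \<subseteq> word_supp c" for c c'
  proof -
    obtain u v u' v' where cw: "u \<in> K" "u' \<in> K"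
      "c = codeword q m xs D u v" "c' = codeword q m xs D u' v'"
      using c(1,2) by (auto simp: code_of_def)
    have "u' * char_fun D x + field_Tr q m (v' * x) = 0"
      if x: "x \<noteq> 0" "u * char_fun D x + field_Tr q m (v * x) = 0" for x
    proof -
      \<comment> \<open>Every nonzero \<open>x\<close> is a coordinate, so inclusion of supports
        transfers zeros of \<open>c\<close> to zeros of \<open>c'\<close>.\<close>
      obtain i where "i < length xs" "xs ! i = x"
        using x(1) assms(11) by (metis DiffI UNIV_I in_set_conv_nth singletonD)
      then show ?thesis
        using c(3) x(2) by (auto simp: cw codeword_def word_supp_def)
    qed
    then obtain a where "a \<in> K" "\<And>x. u' * char_fun D x + field_Tr q m (v' * x) =
        a * (u * char_fun D x + field_Tr q m (v * x))"
      using support_minimal[OF cw(1,2)] by blast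
    then show ?thesis
      by (auto simp: cw codeword_def)
  qed
  show ?thesis
    using linear_code_code_of[OF assms(7) len Tr_in Tr_add Tr_scale] minimal
    by (simp add: minimal_linear_code_def)
qed

end
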